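(* Let $a<b$, let $0<\theta\le1$, let the weight sequence $(t_k)$ be bounded, and let $\hat f_k,\hat f:[a,b]\to L(R)$ ($k\ge1$) be such that $\hat f_k\xrightarrow{WE^{\theta}_{\alpha,\beta}}\hat f$ on $[a,b]$. Then: (i) If $c\in[a,b]$ is such that the limits $\hat u_k=\lim_{x\to c}\hat f_k(x)$ ($k\ge1$) and $\hat u=\lim_{x\to c}\hat f(x)$ exist in $(L(R),d)$, then $\lim_{x\to c}\hat f_k\xrightarrow{WE^{\theta}_{\alpha,\beta}}\lim_{x\to c}\hat f$, i.e. for every $\varepsilon>0$, $\lim_{n\to\infty}\frac{1}{T_{\alpha\beta(n)}^{\theta}}|\{k\in\mathbb{N}:k\le T_{\alpha\beta(n)},\ t_kd(\hat u_k,\hat u)\ge\varepsilon\}|=0$. (ii) If all $\hat f_k$ are continuous at some point $c\in[a,b]$, then $\hat f$ is continuous at $c$. (iii) If $(\hat f_k)$ is uniformly bounded on $[a,b]$, then $\hat f$ is bounded on $[a,b]$.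
   Context: $L(R)$ is the set of fuzzy numbers: functions $\hat x:\mathbb{R}\to[0,1]$ that are normal (attain the value 1), fuzzy convex ($\hat x(\lambda s+(1-\lambda)t)\ge\min\{\hat x(s),\hat x(t)\}$ for $s,t\in\mathbb{R}$ and $\lambda\in[0,1]$), upper semicontinuous, and such that the closure $[\hat x]_0$ of $\{t:\hat x(t)>0\}$ is compact. For $0<r\le1$ the $r$-cut is $[\hat x]_r=\{t:\hat x(t)\ge r\}$; each cut is a compact interval $[\hat x]_r=[(\hat x)_r^-,(\hat x)_r^+]$, $r\in[0,1]$. The metric on $L(R)$ is $d(\hat x,\hat y)=\sup_{0\le r\le1}\max\{|(\hat x)_r^--(\hat y)_r^-|,|(\hat x)_r^+-(\hat y)_r^+|\}$. Limits and continuity of functions $[a,b]\to L(R)$ are with respect to $d$ (one-sided at the endpoints). $\bar 0\in L(R)$ is the fuzzy number equal to $1$ at $0$ and $0$ elsewhere; $\hat f$ is bounded if $\sup_{x\in[a,b]}d(\hat f(x),\bar0)<\infty$, and $(\hat f_k)$ is uniformly bounded if $\sup_{k}\sup_{x\in[a,b]}d(\hat f_k(x),\bar0)<\infty$. Fixed data: $(\alpha_n),(\beta_n)$ are non-decreasing sequences of positive numbers with $\beta_n\ge\alpha_n$ and $\beta_n-\alpha_n\to\infty$; $(t_k)_{k\ge1}$ is a sequence of non-negative reals with $\liminf_k t_k>0$; $T_{\alpha\beta(n)}=\sum_{k\in\mathbb{N},\,k\in[\alpha_n,\beta_n]}t_k$ (which is positive for all large $n$). $\hat f_k\xrightarrow{WE^{\theta}_{\alpha,\beta}}\hat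 f$ on $[a,b]$ (weighted $\alpha\beta$-equi-statistical convergence of order $\theta$) means: for every $\varepsilon>0$, $S_m(x)=\frac{1}{T_{\alpha\beta(m)}^{\theta}}|\{k\in\mathbb{N}:k\le T_{\alpha\beta(m)},\ t_kd(\hat f_k(x),\hat f(x))\ge\varepsilon\}|$ converges to $0$ as $m\to\infty$ uniformly in $x\in[a,b]$, where $|\cdot|$ denotes cardinality. *)

theory Defs
  imports "HOL-Analysis.Analysis"
begin

definition fuzzy_convex :: "(real \<Rightarrow> real) \<Rightarrow> bool" where
  "fuzzy_convex x \<longleftrightarrow>
    (\<forall>s t. \<forall>l\<in>{0..1}. min (x s) (x t) \<le> x (l * s + (1 - l) * t))"

definition upper_semicont :: "(real \<Rightarrow> real) \<Rightarrow> bool" where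
  "upper_semicont x \<longleftrightarrow> (\<forall>t. \<forall>y. x t < y \<longrightarrow> (\<forall>\<^sub>F s in at t. x s < y))"

definition fuzzy_numbers :: "(real \<Rightarrow> real) set" where
  "fuzzy_numbers = {x. range x \<subseteq> {0..1} \<and> (\<exists>t. x t = 1) \<and> fuzzy_convex x \<and>
     upper_semicont x \<and> compact (closure {t. 0 < x t})}"

lemma crisp_zero_mem: "(\<lambda>t. if t = 0 then 1 else 0) \<in> fuzzy_numbers"
proof -
  let ?z = "\<lambda>t::real. if t = 0 then 1 else (0::real)"
  have "upper_semicont ?z"
    unfolding upper_semicont_def
  proof (intro allI impI)
    fix t y :: real assume y: "?z t < y"
    show "\<forall>\<^sub>F s in at t. ?z s < y"
    proof (cases "t = 0")
      case True
      with y have "?z s < y" for s by (simp split: if_splits)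
      then show ?thesis by (simp only: eventually_True)
    next
      case False
      then have "\<forall>\<^sub>F s in at t. s \<noteq> 0"
        by (rule tendsto_imp_eventually_ne[OF tendsto_ident_at])
      then show ?thesis
        by (rule eventually_mono) (use y False in simp)
    qed
  qed
  moreover have "fuzzy_convex ?z"
    unfolding fuzzy_convex_def
  proof (intro allI ballI)
    fix s t l :: real
    show "min (?z s) (?z t) \<le> ?z (l * s + (1 - l) * t)"
      by (cases "s = 0"; cases "t = 0") simp_all
  qed
  moreover have "{t. 0 < ?z t} = {0}" by auto
  then have "compact (closure {t. 0 < ?z t})" by simp
  moreover have "range ?z \<subseteq> {0..1}" by auto
  moreover have "\<exists>t. ?z t = 1" by (intro exI[of _ 0]) simp
  ultimately show ?thesis unfolding fuzzy_numbers_def by blast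
qed

typedef fuzzy = fuzzy_numbers
  using crisp_zero_mem by blast

definition fuzzy_zero :: fuzzy where
  "fuzzy_zero = Abs_fuzzy (\<lambda>t. if t = 0 then 1 else 0)"

lemma Rep_fuzzy_zero: "Rep_fuzzy fuzzy_zero = (\<lambda>t. if t = 0 then 1 else 0)"
  unfolding fuzzy_zero_def using crisp_zero_mem by (rule Abs_fuzzy_inverse)

text \<open>At \<open>r = 0\<close> the cut is the closed support, not the superlevel set (which is all of \<open>\<real>\<close>).\<close>

definition level_cut :: "fuzzy \<Rightarrow> real \<Rightarrow> real set" where
  "level_cut x r = (if r = 0 then closure {t. 0 < Rep_fuzzy x t} else {t. r \<le> Rep_fuzzy x t})"

definition cut_lower :: "fuzzy \<Rightarrow> real \<Rightarrow> real" where
  "cut_lower x r = Inf (level_cut x r)"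

definition cut_upper :: "fuzzy \<Rightarrow> real \<Rightarrow> real" where
  "cut_upper x r = Sup (level_cut x r)"

lemma Rep_fuzzy_bounds: "0 \<le> Rep_fuzzy x t" "Rep_fuzzy x t \<le> 1"
proof -
  have "range (Rep_fuzzy x) \<subseteq> {0..1}"
    using Rep_fuzzy[of x] by (auto simp: fuzzy_numbers_def)
  then have "Rep_fuzzy x t \<in> {0..1}" by (rule range_subsetD)
  then show "0 \<le> Rep_fuzzy x t" "Rep_fuzzy x t \<le> 1" by simp_all
qed

lemma cut_nonempty:
  assumes "r \<in> {0..1}"
  shows "level_cut x r \<noteq> {}"
proof -
  obtain t where "Rep_fuzzy x t = 1"
    using Rep_fuzzy[of x] by (auto simp: fuzzy_numbers_def)
  then have "t \<in> level_cut x r"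
    using assms closure_subset[of "{t. 0 < Rep_fuzzy x t}"] by (auto simp: level_cut_def)
  then show ?thesis by blast
qed

lemma cut_subset_cut_0:
  assumes "r \<in> {0..1}"
  shows "level_cut x r \<subseteq> level_cut x 0"
  using assms closure_subset[of "{t. 0 < Rep_fuzzy x t}"] by (auto simp: level_cut_def)

lemma convex_cut:
  assumes "r \<in> {0..1}"
  shows "convex (level_cut x r)"
proof -
  have fc: "fuzzy_convex (Rep_fuzzy x)"
    using Rep_fuzzy[of x] by (auto simp: fuzzy_numbers_def)
  have step: "min (Rep_fuzzy x s) (Rep_fuzzy x t) \<le> Rep_fuzzy x (u * s + v * t)"
    if "0 \<le> u" "0 \<le> v" "u + v = 1" for s t u v
  proof -
    have "v = 1 - u" "u \<in> {0..1}" using that by auto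
    then show ?thesis using fc unfolding fuzzy_convex_def by blast
  qed
  have "convex {t. r \<le> Rep_fuzzy x t}"
    unfolding convex_def
  proof (clarsimp)
    fix s t u v :: real
    assume "r \<le> Rep_fuzzy x s" "r \<le> Rep_fuzzy x t" "0 \<le> u" "0 \<le> v" "u + v = 1"
    then show "r \<le> Rep_fuzzy x (u * s + v * t)"
      using step[of u v s t] by linarith
  qed
  moreover have "convex {t. 0 < Rep_fuzzy x t}"
    unfolding convex_def
  proof (clarsimp)
    fix s t u v :: real
    assume "0 < Rep_fuzzy x s" "0 < Rep_fuzzy x t" "0 \<le> u" "0 \<le> v" "u + v = 1"
    then show "0 < Rep_fuzzy x (u * s + v * t)"
      using step[of u v s t] by linarith
  qed
  ultimately show ?thesis by (simp add: level_cut_def)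
qed

lemma compact_cut:
  assumes "r \<in> {0..1}"
  shows "compact (level_cut x r)"
proof -
  have c0: "compact (level_cut x 0)" and usc: "upper_semicont (Rep_fuzzy x)"
    using Rep_fuzzy[of x] by (auto simp: fuzzy_numbers_def level_cut_def)
  have "open {t. Rep_fuzzy x t < r}"
    unfolding open_dist
  proof clarify
    fix t assume t: "Rep_fuzzy x t < r"
    with usc have "\<forall>\<^sub>F s in at t. Rep_fuzzy x s < r"
      by (auto simp: upper_semicont_def)
    then obtain e where "e > 0" "\<And>s. s \<noteq> t \<Longrightarrow> dist s t < e \<Longrightarrow> Rep_fuzzy x s < r"
      by (auto simp: eventually_at)
    with t show "\<exists>e>0. \<forall>s. dist s t < e \<longrightarrow> s \<in> {t. Rep_fuzzy x t < r}"
      by (metis mem_Collect_eq)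
  qed
  then have "closed {t. r \<le> Rep_fuzzy x t}"
    by (simp add: closed_def Compl_eq not_le)
  then have "closed (level_cut x r)" by (auto simp: level_cut_def)
  then show ?thesis
    using c0 cut_subset_cut_0[OF assms, of x] by (meson bounded_subset compact_eq_bounded_closed)
qed

lemma cut_eq_interval:
  assumes "r \<in> {0..1}"
  shows "level_cut x r = {cut_lower x r..cut_upper x r}"
proof -
  obtain l u where lu: "level_cut x r = {l..u}"
    using convex_cut[OF assms, of x] compact_cut[OF assms, of x]
      convex_connected connected_compact_interval_1 by metis
  with cut_nonempty[OF assms, of x] have "l \<le> u" by auto
  with lu show ?thesis by (simp add: cut_lower_def cut_upper_def)
qed

lemma fuzzy_eqI:
  assumes "\<And>r. r \<in> {0..1} \<Longrightarrow> level_cut x r = level_cut y r"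
  shows "x = y"
proof -
  have *: "\<not> Rep_fuzzy v t < Rep_fuzzy w t"
    if "\<And>r. r \<in> {0..1} \<Longrightarrow> level_cut v r = level_cut w r" for v w t
  proof
    assume less: "Rep_fuzzy v t < Rep_fuzzy w t"
    have "0 < Rep_fuzzy w t" using less Rep_fuzzy_bounds(1)[of v t] by linarith
    then have "t \<in> level_cut w (Rep_fuzzy w t)" by (simp add: level_cut_def)
    then have "t \<in> level_cut v (Rep_fuzzy w t)"
      using that Rep_fuzzy_bounds[of w t] by auto
    with less \<open>0 < Rep_fuzzy w t\<close> show False by (simp add: level_cut_def)
  qed
  have "Rep_fuzzy x t = Rep_fuzzy y t" for t
    using *[OF assms, of t] *[OF assms[symmetric], of t] by linarith
  then have "Rep_fuzzy x = Rep_fuzzy y" by (rule ext)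
  then show ?thesis by (simp only: Rep_fuzzy_inject)
qed

definition cut_dist :: "fuzzy \<Rightarrow> fuzzy \<Rightarrow> real \<Rightarrow> real" where
  "cut_dist x y r = max \<bar>cut_lower x r - cut_lower y r\<bar> \<bar>cut_upper x r - cut_upper y r\<bar>"

lemma cut_ends_bounded:
  obtains B where "\<And>r. r \<in> {0..1} \<Longrightarrow> \<bar>cut_lower z r\<bar> \<le> B"
    and "\<And>r. r \<in> {0..1} \<Longrightarrow> \<bar>cut_upper z r\<bar> \<le> B"
proof -
  have "bounded (level_cut z 0)"
    by (rule compact_imp_bounded[OF compact_cut]) simp
  then obtain B where B: "\<forall>t\<in>level_cut z 0. norm t \<le> B"
    unfolding bounded_iff by blast
  have mem: "cut_lower z r \<in> level_cut z 0" "cut_upper z r \<in> level_cut z 0"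
    if r: "r \<in> {0..1}" for r
  proof -
    have "cut_lower z r \<le> cut_upper z r"
      using cut_nonempty[OF r, of z] unfolding cut_eq_interval[OF r, of z] by simp
    then have "cut_lower z r \<in> level_cut z r" "cut_upper z r \<in> level_cut z r"
      unfolding cut_eq_interval[OF r, of z] by simp_all
    then show "cut_lower z r \<in> level_cut z 0" "cut_upper z r \<in> level_cut z 0"
      using subsetD[OF cut_subset_cut_0[OF r, of z]] by blast+
  qed
  show thesis
    by (rule that[of B]; use B mem in \<open>metis real_norm_def\<close>)
qed

lemma bdd_above_cut_dist: "bdd_above (cut_dist x y ` {0..1})"
proof -
  obtain B where B: "\<And>r. r \<in> {0..1} \<Longrightarrow> \<bar>cut_lower x r\<bar> \<le> B"
      "\<And>r. r \<in> {0..1} \<Longrightarrow> \<bar>cut_upper x r\<bar> \<le> B"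
    using cut_ends_bounded[of x] by blast
  obtain C where C: "\<And>r. r \<in> {0..1} \<Longrightarrow> \<bar>cut_lower y r\<bar> \<le> C"
      "\<And>r. r \<in> {0..1} \<Longrightarrow> \<bar>cut_upper y r\<bar> \<le> C"
    using cut_ends_bounded[of y] by blast
  have "cut_dist x y r \<le> B + C" if r: "r \<in> {0..1}" for r
    using B(1)[OF r] B(2)[OF r] C(1)[OF r] C(2)[OF r] unfolding cut_dist_def by linarith
  then show ?thesis by (rule bdd_aboveI2)
qed

instantiation fuzzy :: metric_space
begin

definition dist_fuzzy :: "fuzzy \<Rightarrow> fuzzy \<Rightarrow> real" where
  "dist_fuzzy x y = (SUP r\<in>{0..1}. cut_dist x y r)"

definition uniformity_fuzzy :: "(fuzzy \<times> fuzzy) filter" where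
  "uniformity_fuzzy = (INF e\<in>{0<..}. principal {(x, y). dist x y < e})"

definition open_fuzzy :: "fuzzy set \<Rightarrow> bool" where
  "open_fuzzy U \<longleftrightarrow> (\<forall>x\<in>U. \<forall>\<^sub>F (x', y) in uniformity. x' = x \<longrightarrow> y \<in> U)"

instance
proof
  have dist: "dist x y = (SUP r\<in>{0..1}. cut_dist x y r)" for x y :: fuzzy
    by (simp add: dist_fuzzy_def)
  have upper: "cut_dist x y r \<le> dist x y" if "r \<in> {0..1}" for x y r
    unfolding dist using bdd_above_cut_dist that by (rule cSUP_upper2) simp
  have least: "dist x y \<le> B" if "\<And>r. r \<in> {0..1} \<Longrightarrow> cut_dist x y r \<le> B" for x y B
    unfolding dist by (rule cSUP_least) (use that in auto)
  fix x y z :: fuzzy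
  show "dist x y = 0 \<longleftrightarrow> x = y"
  proof
    assume 0: "dist x y = 0"
    show "x = y"
    proof (rule fuzzy_eqI)
      fix r :: real assume r: "r \<in> {0..1}"
      then have "cut_dist x y r \<le> 0" using upper[of r x y] 0 by simp
      then have "cut_lower x r = cut_lower y r" "cut_upper x r = cut_upper y r"
        by (auto simp: cut_dist_def)
      then show "level_cut x r = level_cut y r" using cut_eq_interval[OF r] by simp
    qed
  qed (simp add: dist_fuzzy_def cut_dist_def)
  show "dist x y \<le> dist x z + dist y z"
  proof (rule least)
    fix r :: real assume r: "r \<in> {0..1}"
    have "cut_dist x y r \<le> cut_dist x z r + cut_dist y z r"
      unfolding cut_dist_def by linarith
    also have "\<dots> \<le> dist x z + dist y z" using upper[OF r] by (intro add_mono)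
    finally show "cut_dist x y r \<le> dist x z + dist y z" .
  qed
qed (simp_all add: uniformity_fuzzy_def open_fuzzy_def)

end

text \<open>Throughout, sequences indexed by \<open>k\<close> start at \<open>k = 1\<close>; values at \<open>k = 0\<close> are ignored.\<close>

definition weight_sum :: "(nat \<Rightarrow> real) \<Rightarrow> (nat \<Rightarrow> real) \<Rightarrow> (nat \<Rightarrow> real) \<Rightarrow> nat \<Rightarrow> real" where
  "weight_sum \<alpha> \<beta> t n = (\<Sum>k | 1 \<le> k \<and> real k \<in> {\<alpha> n..\<beta> n}. t k)"

text \<open>Where the weight sum is 0 the ratio is 0; under the standing assumptions on
  \<open>\<alpha>\<close>, \<open>\<beta>\<close>, \<open>t\<close> this concerns only finitely many \<open>n\<close>.\<close>

definition weighted_ratio ::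
  "(nat \<Rightarrow> real) \<Rightarrow> (nat \<Rightarrow> real) \<Rightarrow> (nat \<Rightarrow> real) \<Rightarrow> real \<Rightarrow> real \<Rightarrow>
    (nat \<Rightarrow> 'a::metric_space) \<Rightarrow> 'a \<Rightarrow> nat \<Rightarrow> real" where
  "weighted_ratio \<alpha> \<beta> t \<theta> \<epsilon> u v n =
     real (card {k. 1 \<le> k \<and> real k \<le> weight_sum \<alpha> \<beta> t n \<and> \<epsilon> \<le> t k * dist (u k) v})
       / weight_sum \<alpha> \<beta> t n powr \<theta>"

definition weighted_stat_conv ::
  "(nat \<Rightarrow> real) \<Rightarrow> (nat \<Rightarrow> real) \<Rightarrow> (nat \<Rightarrow> real) \<Rightarrow> real \<Rightarrow>
    (nat \<Rightarrow> 'a::metric_space) \<Rightarrow> 'a \<Rightarrow> bool" where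
  "weighted_stat_conv \<alpha> \<beta> t \<theta> u v \<longleftrightarrow>
     (\<forall>\<epsilon>>0. weighted_ratio \<alpha> \<beta> t \<theta> \<epsilon> u v \<longlonglongrightarrow> 0)"

definition weighted_equi_stat_conv ::
  "(nat \<Rightarrow> real) \<Rightarrow> (nat \<Rightarrow> real) \<Rightarrow> (nat \<Rightarrow> real) \<Rightarrow> real \<Rightarrow>
    'b set \<Rightarrow> (nat \<Rightarrow> 'b \<Rightarrow> 'a::metric_space) \<Rightarrow> ('b \<Rightarrow> 'a) \<Rightarrow> bool" where
  "weighted_equi_stat_conv \<alpha> \<beta> t \<theta> S f g \<longleftrightarrow>
     (\<forall>\<epsilon>>0. uniform_limit S (\<lambda>m x. weighted_ratio \<alpha> \<beta> t \<theta> \<epsilon> (\<lambda>k. f k x) (g x) m) (\<lambda>_. 0)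
        sequentially)"

definition fuzzy_bounded_on :: "'b set \<Rightarrow> ('b \<Rightarrow> fuzzy) \<Rightarrow> bool" where
  "fuzzy_bounded_on S g \<longleftrightarrow> (SUP x\<in>S. ereal (dist (g x) fuzzy_zero)) < \<infinity>"

definition fuzzy_unif_bounded_on :: "'b set \<Rightarrow> (nat \<Rightarrow> 'b \<Rightarrow> fuzzy) \<Rightarrow> bool" where
  "fuzzy_unif_bounded_on S f \<longleftrightarrow> (SUP k\<in>{1..}. SUP x\<in>S. ereal (dist (f k x) fuzzy_zero)) < \<infinity>"

end

theory Submission
  imports Defs
begin

text \<open>The weights are eventually bounded below by some \<open>\<delta> > 0\<close>, so \<open>T\<^sub>n \<rightarrow> \<infinity>\<close>, and for one fixed
  large \<open>m\<close> the exceptional indices at any point number less than \<open>T\<^sub>m / 4\<close>. Hence any two points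
  share an index \<open>k \<le> T\<^sub>m\<close> at which \<open>f\<^sub>k\<close> is close to the limit function. Since only finitely many
  indices are involved, continuity at \<open>c\<close> is a three-epsilon argument, and boundedness is immediate.
  For (i), as \<open>x \<rightarrow> c\<close> the exceptional set of the limits at level \<open>\<epsilon>\<close> is, for each fixed \<open>n\<close>,
  contained in the exceptional set at \<open>x\<close> at level \<open>\<epsilon> / 2\<close>.\<close>

section \<open>Growth of the weight sums\<close>

lemma pos_liminf_eventually_gt:
  fixes t :: "nat \<Rightarrow> real"
  assumes "0 < liminf (\<lambda>k. ereal (t k))"
  obtains \<delta> where "0 < \<delta>" and "\<forall>\<^sub>F k in sequentially. \<delta> < t k"
proof -
  obtain \<delta> where d: "ereal 0 < ereal \<delta>" "ereal \<delta> < liminf (\<lambda>k. ereal (t k))"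
    using ereal_dense2[of 0 "liminf (\<lambda>k. ereal (t k))"] assms by (auto simp: zero_ereal_def)
  have "\<forall>\<^sub>F k in sequentially. \<delta> < t k"
    using less_LiminfD[OF d(2)] by simp
  with d(1) show thesis by (intro that) auto
qed

lemma finite_nat_real_le: "finite {k::nat. real k \<le> T}"
  by (rule finite_subset[of _ "{..nat \<lfloor>T\<rfloor>}"]) (auto simp: le_nat_floor)

text \<open>Every index past \<open>K\<close> in the window \<open>[\<alpha> n, \<beta> n]\<close>
  contributes at least \<open>\<delta>\<close>, and there are at least
  \<open>\<beta> n - \<alpha> n - 1 - K\<close> of them.\<close>

lemma weight_sum_at_top:
  assumes diff: "filterlim (\<lambda>n. \<beta> n - \<alpha> n) at_top sequentially"
    and pos: "\<And>n. 0 < \<alpha> n"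
    and nonneg: "\<And>k. 1 \<le> k \<Longrightarrow> 0 \<le> t k"
    and liminf: "0 < liminf (\<lambda>k. ereal (t k))"
  shows "filterlim (weight_sum \<alpha> \<beta> t) at_top sequentially"
proof -
  obtain \<delta> K where \<delta>: "0 < \<delta>" and K: "\<And>k. K \<le> k \<Longrightarrow> \<delta> < t k"
    using pos_liminf_eventually_gt[OF liminf] unfolding eventually_sequentially by metis
  have bound: "\<delta> * ((\<beta> n - \<alpha> n) + (- 1 - real K)) \<le> weight_sum \<alpha> \<beta> t n" for n
  proof -
    \<comment> \<open>Shifting the left end by \<open>K\<close> forces \<open>K \<le> k\<close>,
      hence \<open>\<delta> < t k\<close>, wherever \<open>\<alpha> n\<close> lies.\<close>
    let ?A = "{nat \<lceil>\<alpha> n\<rceil> + K..nat \<lfloor>\<beta> n\<rfloor>}" and ?B = "{k. 1 \<le> k \<and> real k \<in> {\<alpha> n..\<beta> n}}"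
    have fin: "finite ?B"
      by (rule finite_subset[OF _ finite_nat_real_le[of "\<beta> n"]]) auto
    have sub: "?A \<subseteq> ?B"
    proof
      fix k assume k: "k \<in> ?A"
      have "0 < \<lceil>\<alpha> n\<rceil>" using pos[of n] by simp
      then have 1: "1 \<le> nat \<lceil>\<alpha> n\<rceil>" by linarith
      have k1: "1 \<le> k" using k 1 by simp
      have "nat \<lceil>\<alpha> n\<rceil> \<le> k" using k unfolding atLeastAtMost_iff by linarith
      then have "\<alpha> n \<le> real k" using real_nat_ceiling_ge[of "\<alpha> n"] by linarith
      moreover have "real k \<le> \<beta> n"
        using k k1 unfolding atLeastAtMost_iff by linarith
      ultimately show "k \<in> ?B" using k1 by simp
    qed
    \<comment> \<open>Rounding costs less than 1 at each end and counting both endpoints gives 1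
      back, whence the \<open>- 1\<close>. Truncated subtraction for an empty \<open>?A\<close> only
      helps.\<close>
    have "\<beta> n - \<alpha> n + (- 1 - real K) \<le> real (card ?A)"
    proof -
      have "\<beta> n < real (nat \<lfloor>\<beta> n\<rfloor>) + 1" by linarith
      moreover have "real (nat \<lceil>\<alpha> n\<rceil>) < \<alpha> n + 1" using pos[of n] by linarith
      ultimately show ?thesis by simp
    qed
    then have "\<delta> * (\<beta> n - \<alpha> n + (- 1 - real K)) \<le> \<delta> * real (card ?A)"
      using \<delta> by (intro mult_left_mono) auto
    also have "\<dots> \<le> (\<Sum>k\<in>?A. t k)"
      using sum_mono[of ?A "\<lambda>_. \<delta>" t] K by (force simp: mult.commute less_imp_le)
    also have "\<dots> \<le> (\<Sum>k\<in>?B. t k)"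
      using fin sub nonneg by (intro sum_mono2) auto
    finally show ?thesis by (simp add: weight_sum_def)
  qed
  have "filterlim (\<lambda>n. (- 1 - real K) + (\<beta> n - \<alpha> n)) at_top sequentially"
    using diff by (intro filterlim_tendsto_add_at_top[OF tendsto_const])
  then have "filterlim (\<lambda>n. \<delta> * ((- 1 - real K) + (\<beta> n - \<alpha> n))) at_top sequentially"
    using \<delta> by (intro filterlim_tendsto_pos_mult_at_top[OF tendsto_const])
  then show ?thesis
    by (rule filterlim_at_top_mono) (use bound in \<open>simp add: add.commute\<close>)
qed

section \<open>Exceptional index sets: size and passage to limits\<close>

lemma weighted_ratio_nonneg: "0 \<le> weighted_ratio \<alpha> \<beta> t \<theta> \<epsilon> u v n"
  by (simp add: weighted_ratio_def)

text \<open>For fixed \<open>n\<close> both ratios have the same denominator, so comparing the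
  counted sets suffices. The larger set inherits its index range from the smaller one.\<close>

lemma weighted_ratio_mono:
  assumes "{k. 1 \<le> k \<and> real k \<le> weight_sum \<alpha> \<beta> t n \<and> \<epsilon> \<le> t k * dist (u k) v}
      \<subseteq> {k. \<epsilon>' \<le> t k * dist (u' k) v'}"
  shows "weighted_ratio \<alpha> \<beta> t \<theta> \<epsilon> u v n \<le> weighted_ratio \<alpha> \<beta> t \<theta> \<epsilon>' u' v' n"
proof -
  have "finite {k. 1 \<le> k \<and> real k \<le> weight_sum \<alpha> \<beta> t n \<and> \<epsilon>' \<le> t k * dist (u' k) v'}"
    by (rule finite_subset[OF _ finite_nat_real_le[of "weight_sum \<alpha> \<beta> t n"]]) auto
  then show ?thesis
    unfolding weighted_ratio_def
    by (intro divide_right_mono of_nat_mono card_mono) (use assms in auto)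
qed

text \<open>Since \<open>\<theta> \<le> 1\<close> and the weight sum \<open>T\<close> is at least 1,
  \<open>T powr \<theta> \<le> T\<close>. A small ratio of order \<open>\<theta>\<close> thus bounds
  the count by a proportion of \<open>T\<close> itself, comparable with the number of all indices up
  to \<open>T\<close>.\<close>

lemma card_exceptional_less:
  assumes "weighted_ratio \<alpha> \<beta> t \<theta> \<epsilon> u v n < \<eta>" and "1 \<le> weight_sum \<alpha> \<beta> t n" and "\<theta> \<le> 1"
  shows "real (card {k. 1 \<le> k \<and> real k \<le> weight_sum \<alpha> \<beta> t n \<and> \<epsilon> \<le> t k * dist (u k) v})
    < \<eta> * weight_sum \<alpha> \<beta> t n"
proof -
  let ?T = "weight_sum \<alpha> \<beta> t n"
  have "0 < \<eta>"
    using assms(1) weighted_ratio_nonneg[of \<alpha> \<beta> t \<theta> \<epsilon> u v n] by linarith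
  moreover have "?T powr \<theta> \<le> ?T"
    using powr_mono[OF assms(3,2)] assms(2) by simp
  ultimately have "\<eta> * ?T powr \<theta> \<le> \<eta> * ?T" by simp
  then show ?thesis
    using assms(1,2) by (simp add: weighted_ratio_def divide_less_eq)
qed

text \<open>An arbitrary nontrivial filter living on \<open>S\<close> treats one-sided limits at
  endpoints together with interior ones.\<close>

lemma weighted_stat_conv_limits:
  assumes conv: "weighted_equi_stat_conv \<alpha> \<beta> t \<theta> S f g"
    and F: "F \<noteq> bot" "\<forall>\<^sub>F x in F. x \<in> S"
    and f: "\<And>k. 1 \<le> k \<Longrightarrow> (f k \<longlongrightarrow> u k) F" and g: "(g \<longlongrightarrow> v) F"
  shows "weighted_stat_conv \<alpha> \<beta> t \<theta> u v"
  unfolding weighted_stat_conv_def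
proof (intro allI impI)
  fix \<epsilon> :: real assume \<epsilon>: "0 < \<epsilon>"
  show "weighted_ratio \<alpha> \<beta> t \<theta> \<epsilon> u v \<longlonglongrightarrow> 0"
  proof (rule tendstoI)
    fix \<eta> :: real assume \<eta>: "0 < \<eta>"
    have "uniform_limit S (\<lambda>m x. weighted_ratio \<alpha> \<beta> t \<theta> (\<epsilon> / 2) (\<lambda>k. f k x) (g x) m)
        (\<lambda>_. 0) sequentially"
      using conv \<epsilon> by (simp add: weighted_equi_stat_conv_def)
    from uniform_limitD[OF this \<eta>]
    show "\<forall>\<^sub>F n in sequentially. dist (weighted_ratio \<alpha> \<beta> t \<theta> \<epsilon> u v n) 0 < \<eta>"
    proof (rule eventually_mono)
      fix n
      let ?A = "{k. 1 \<le> k \<and> real k \<le> weight_sum \<alpha> \<beta> t n \<and> \<epsilon> \<le> t k * dist (u k) v}"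
      assume small: "\<forall>x\<in>S. dist (weighted_ratio \<alpha> \<beta> t \<theta> (\<epsilon> / 2) (\<lambda>k. f k x) (g x) n) 0 < \<eta>"
      have "finite ?A"
        by (rule finite_subset[OF _ finite_nat_real_le[of "weight_sum \<alpha> \<beta> t n"]]) auto
      \<comment> \<open>On \<open>?A\<close> the limit of the weighted distance is at least
        \<open>\<epsilon>\<close>; halving the level leaves the strict gap that makes the bound hold
        near the limit.\<close>
      moreover have "\<forall>\<^sub>F x in F. \<epsilon> / 2 < t k * dist (f k x) (g x)" if "k \<in> ?A" for k
      proof (rule order_tendstoD(1))
        show "((\<lambda>x. t k * dist (f k x) (g x)) \<longlongrightarrow> t k * dist (u k) v) F"
          using that f g by (intro tendsto_intros) auto
        show "\<epsilon> / 2 < t k * dist (u k) v" using that \<epsilon> by auto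
      qed
      ultimately have "\<forall>\<^sub>F x in F. \<forall>k\<in>?A. \<epsilon> / 2 < t k * dist (f k x) (g x)"
        by (intro eventually_ball_finite ballI)
      \<comment> \<open>The point \<open>x\<close> depends on \<open>n\<close>; uniformity over
        \<open>S\<close> lets one threshold on \<open>n\<close> serve all these points.\<close>
      then have "\<exists>x. x \<in> S \<and> (\<forall>k\<in>?A. \<epsilon> / 2 < t k * dist (f k x) (g x))"
        using F eventually_happens'[OF F(1) eventually_conj] by blast
      then obtain x where x: "x \<in> S" "\<forall>k\<in>?A. \<epsilon> / 2 < t k * dist (f k x) (g x)" by blast
      have "weighted_ratio \<alpha> \<beta> t \<theta> \<epsilon> u v n
          \<le> weighted_ratio \<alpha> \<beta> t \<theta> (\<epsilon> / 2) (\<lambda>k. f k x) (g x) n"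
        by (rule weighted_ratio_mono) (use x(2) in \<open>auto intro: less_imp_le\<close>)
      then show "dist (weighted_ratio \<alpha> \<beta> t \<theta> \<epsilon> u v n) 0 < \<eta>"
        using small x(1) weighted_ratio_nonneg[of \<alpha> \<beta> t \<theta> \<epsilon> u v n] by fastforce
    qed
  qed
qed

section \<open>Common good indices and continuity of the limit function\<close>

lemma common_good_index:
  assumes conv: "weighted_equi_stat_conv \<alpha> \<beta> t \<theta> S f g"
    and top: "filterlim (weight_sum \<alpha> \<beta> t) at_top sequentially"
    and liminf: "0 < liminf (\<lambda>k. ereal (t k))"
    and \<theta>: "\<theta> \<le> 1" and \<epsilon>: "0 < \<epsilon>"
  obtains N where "\<And>x y. x \<in> S \<Longrightarrow> y \<in> S \<Longrightarrow>
    \<exists>k\<in>{1..N}. dist (f k x) (g x) < \<epsilon> \<and> dist (f k y) (g y) < \<epsilon>"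
proof -
  obtain \<delta> K where \<delta>: "0 < \<delta>" and K: "\<And>k. K \<le> k \<Longrightarrow> \<delta> < t k"
    using pos_liminf_eventually_gt[OF liminf] unfolding eventually_sequentially by metis
  let ?T = "weight_sum \<alpha> \<beta> t"
  \<comment> \<open>At level \<open>\<delta> * \<epsilon>\<close>, an index \<open>k \<ge> K\<close>
    that is not exceptional has distance below \<open>\<epsilon>\<close>, because
    \<open>\<delta> < t k\<close>. The proportion 1/4 leaves two points with fewer than
    \<open>T / 2\<close> exceptional indices together.\<close>
  have "uniform_limit S (\<lambda>m x. weighted_ratio \<alpha> \<beta> t \<theta> (\<delta> * \<epsilon>) (\<lambda>k. f k x) (g x) m)
      (\<lambda>_. 0) sequentially"
    using conv \<delta> \<epsilon> by (simp add: weighted_equi_stat_conv_def)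
  then have "\<forall>\<^sub>F m in sequentially.
      \<forall>x\<in>S. dist (weighted_ratio \<alpha> \<beta> t \<theta> (\<delta> * \<epsilon>) (\<lambda>k. f k x) (g x) m) 0 < 1 / 4"
    by (rule uniform_limitD) simp
  \<comment> \<open>Without a common index,
    \<open>T - 1 < N \<le> K + |bad x| + |bad y| < K + T / 2\<close>, so
    \<open>T < 2 * K + 2\<close>; the threshold contradicts this and also ensures
    \<open>1 \<le> T\<close>.\<close>
  moreover have "\<forall>\<^sub>F m in sequentially. 2 * real K + 3 \<le> ?T m"
    using top by (simp add: filterlim_at_top)
  ultimately have "\<forall>\<^sub>F m in sequentially. 2 * real K + 3 \<le> ?T m \<and>
      (\<forall>x\<in>S. dist (weighted_ratio \<alpha> \<beta> t \<theta> (\<delta> * \<epsilon>) (\<lambda>k. f k x) (g x) m) 0 < 1 / 4)"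
    by eventually_elim simp
  then obtain m where m: "2 * real K + 3 \<le> ?T m"
      "\<And>x. x \<in> S \<Longrightarrow> weighted_ratio \<alpha> \<beta> t \<theta> (\<delta> * \<epsilon>) (\<lambda>k. f k x) (g x) m < 1 / 4"
    using eventually_happens'[OF sequentially_bot] by fastforce
  define N where "N = nat \<lfloor>?T m\<rfloor>"
  define bad where
    "bad x = {k. 1 \<le> k \<and> real k \<le> ?T m \<and> \<delta> * \<epsilon> \<le> t k * dist (f k x) (g x)}" for x
  have card_bad: "real (card (bad x)) < 1 / 4 * ?T m" if "x \<in> S" for x
    unfolding bad_def using m that \<theta> by (intro card_exceptional_less) auto
  have finite_bad: "finite (bad x)" for x
    unfolding bad_def by (rule finite_subset[OF _ finite_nat_real_le[of "?T m"]]) auto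
  have N_le: "real N \<le> ?T m" and N_gt: "?T m < real N + 1"
    using m(1) unfolding N_def by linarith+
  show thesis
  proof (rule that[of N], rule ccontr)
    fix x y assume xy: "x \<in> S" "y \<in> S"
    assume none: "\<not> (\<exists>k\<in>{1..N}. dist (f k x) (g x) < \<epsilon> \<and> dist (f k y) (g y) < \<epsilon>)"
    have mem: "k \<in> bad z" if "k \<in> {1..N}" "K \<le> k" "\<not> dist (f k z) (g z) < \<epsilon>" for k z
    proof -
      have "\<delta> * \<epsilon> \<le> t k * dist (f k z) (g z)"
        using K[OF that(2)] that(3) \<delta> \<epsilon> by (intro mult_mono) auto
      moreover have "real k \<le> ?T m" using that(1) N_le by auto
      ultimately show ?thesis using that(1) by (simp add: bad_def)
    qed
    \<comment> \<open>Indices below \<open>K\<close> are counted apart: there \<open>t k\<close> may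
      be arbitrarily small or zero, so a large distance need not make \<open>k\<close>
      exceptional.\<close>
    have "{1..N} \<subseteq> {..<K} \<union> (bad x \<union> bad y)"
      using none mem by (force simp: not_less)
    then have "card {1..N} \<le> card ({..<K} \<union> (bad x \<union> bad y))"
      using finite_bad by (intro card_mono) auto
    also have "\<dots> \<le> K + (card (bad x) + card (bad y))"
      using card_Un_le[of "{..<K}" "bad x \<union> bad y"] card_Un_le[of "bad x" "bad y"] by simp
    finally have "real N \<le> real K + (real (card (bad x)) + real (card (bad y)))"
      by simp
    then show False
      using card_bad[OF xy(1)] card_bad[OF xy(2)] N_gt m(1) by linarith
  qed
qed

text \<open>The good index may change with \<open>x\<close>, but it serves \<open>x\<close> and
  \<open>c\<close> at once and stays in the fixed range \<open>{1..N}\<close>. Intersecting finitely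
  many neighbourhoods of \<open>c\<close> therefore controls all candidates.\<close>

lemma continuous_equi_stat_limit:
  fixes f :: "nat \<Rightarrow> 'b::t2_space \<Rightarrow> 'a::metric_space"
  assumes good: "\<And>\<epsilon>. 0 < \<epsilon> \<Longrightarrow> \<exists>N. \<forall>x\<in>S. \<forall>y\<in>S.
      \<exists>k\<in>{1..N}. dist (f k x) (g x) < \<epsilon> \<and> dist (f k y) (g y) < \<epsilon>"
    and c: "c \<in> S" and cont: "\<And>k. 1 \<le> k \<Longrightarrow> continuous (at c within S) (f k)"
  shows "continuous (at c within S) g"
  unfolding continuous_within
proof (rule tendstoI)
  fix e :: real assume e: "0 < e"
  then obtain N where N: "\<forall>x\<in>S. \<forall>y\<in>S.
      \<exists>k\<in>{1..N}. dist (f k x) (g x) < e / 3 \<and> dist (f k y) (g y) < e / 3"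
    using good[of "e / 3"] by auto
  have "\<forall>\<^sub>F x in at c within S. dist (f k x) (f k c) < e / 3" if "k \<in> {1..N}" for k
    using cont[of k] that e by (intro tendstoD) (auto simp: continuous_within)
  then have "\<forall>\<^sub>F x in at c within S. \<forall>k\<in>{1..N}. dist (f k x) (f k c) < e / 3"
    by (simp add: eventually_ball_finite)
  moreover have "\<forall>\<^sub>F x in at c within S. x \<in> S" by (simp add: eventually_at_filter)
  ultimately show "\<forall>\<^sub>F x in at c within S. dist (g x) (g c) < e"
  proof eventually_elim
    case (elim x)
    then obtain k where k: "k \<in> {1..N}" "dist (f k x) (g x) < e / 3" "dist (f k c) (g c) < e / 3"
      using N c by blast
    then have "dist (f k x) (f k c) < e / 3" using elim(1) by blast
    with k(2,3) have "dist (g x) (f k c) < 2 * (e / 3)"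
      using dist_triangle[of "g x" "f k c" "f k x"] by (simp add: dist_commute)
    with k(3) show ?case using dist_triangle[of "g x" "g c" "f k c"] by linarith
  qed
qed

section \<open>Boundedness, and assembly of the three claims\<close>

lemma fuzzy_bounded_onI:
  assumes "\<And>x. x \<in> S \<Longrightarrow> dist (g x) fuzzy_zero \<le> M"
  shows "fuzzy_bounded_on S g"
proof -
  have "(SUP x\<in>S. ereal (dist (g x) fuzzy_zero)) \<le> ereal M"
    by (rule SUP_least) (use assms in simp)
  also have "\<dots> < \<infinity>" by simp
  finally show ?thesis by (simp add: fuzzy_bounded_on_def)
qed

lemma fuzzy_unif_bounded_onD:
  assumes "fuzzy_unif_bounded_on S f"
  obtains M where "\<And>k x. 1 \<le> k \<Longrightarrow> x \<in> S \<Longrightarrow> dist (f k x) fuzzy_zero \<le> M"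
proof -
  let ?s = "SUP k\<in>{1..}. SUP x\<in>S. ereal (dist (f k x) fuzzy_zero)"
  \<comment> \<open>A supremum below infinity lies strictly below some real, by density of the reals
    in \<open>ereal\<close>.\<close>
  obtain M where M: "?s < ereal M"
    using assms ereal_dense2 unfolding fuzzy_unif_bounded_on_def by blast
  have "dist (f k x) fuzzy_zero \<le> M" if "1 \<le> k" "x \<in> S" for k x
  proof -
    have "ereal (dist (f k x) fuzzy_zero) \<le> (SUP x\<in>S. ereal (dist (f k x) fuzzy_zero))"
      using that(2) by (rule SUP_upper)
    also have "\<dots> \<le> ?s"
      using that(1) by (intro SUP_upper) simp
    also note M
    finally show ?thesis by simp
  qed
  then show thesis by (rule that)
qed

theorem theorem3p7:
  fixes a b \<theta> :: real
    and \<alpha> \<beta> t :: "nat \<Rightarrow> real"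
    and f :: "nat \<Rightarrow> real \<Rightarrow> fuzzy" and g :: "real \<Rightarrow> fuzzy"
  assumes "incseq \<alpha>" and "incseq \<beta>"
    and "\<And>n. 0 < \<alpha> n" and "\<And>n. 0 < \<beta> n" and "\<And>n. \<alpha> n \<le> \<beta> n"
    and "filterlim (\<lambda>n. \<beta> n - \<alpha> n) at_top sequentially"
    and "\<And>k. 1 \<le> k \<Longrightarrow> 0 \<le> t k"
    and "0 < liminf (\<lambda>k. ereal (t k))"
    and "bounded (t ` {1..})"
    and "a < b" and "0 < \<theta>" and "\<theta> \<le> 1"
    and "weighted_equi_stat_conv \<alpha> \<beta> t \<theta> {a..b} f g"
  shows
    "(\<forall>c\<in>{a..b}. \<forall>u v.
        (\<forall>k\<ge>1. (f k \<longlongrightarrow> u k) (at c within {a..b})) \<and> (g \<longlongrightarrow> v) (at c within {a..b})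
          \<longrightarrow> weighted_stat_conv \<alpha> \<beta> t \<theta> u v) \<and>
     (\<forall>c\<in>{a..b}.
        (\<forall>k\<ge>1. continuous (at c within {a..b}) (f k))
          \<longrightarrow> continuous (at c within {a..b}) g) \<and>
     (fuzzy_unif_bounded_on {a..b} f \<longrightarrow> fuzzy_bounded_on {a..b} g)"
proof -
  let ?S = "{a..b}"
  note top = weight_sum_at_top[OF assms(6,3,7,8)]
  have good: "\<exists>N. \<forall>x\<in>?S. \<forall>y\<in>?S.
      \<exists>k\<in>{1..N}. dist (f k x) (g x) < \<epsilon> \<and> dist (f k y) (g y) < \<epsilon>" if "0 < \<epsilon>" for \<epsilon>
    using common_good_index[OF assms(13) top assms(8,12) that] by metis
  have "weighted_stat_conv \<alpha> \<beta> t \<theta> u v"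
    if c: "c \<in> ?S" and lim: "\<forall>k\<ge>1. (f k \<longlongrightarrow> u k) (at c within ?S)" "(g \<longlongrightarrow> v) (at c within ?S)"
    for c u v
  proof (rule weighted_stat_conv_limits[OF assms(13)])
    \<comment> \<open>As \<open>a < b\<close>, each point of the interval, endpoints included, is a
      limit point of it.\<close>
    show "at c within ?S \<noteq> bot"
      using c \<open>a < b\<close> by (simp add: trivial_limit_within islimpt_Icc)
    show "\<forall>\<^sub>F x in at c within ?S. x \<in> ?S" by (simp add: eventually_at_filter)
  qed (use lim in auto)
  moreover have "continuous (at c within ?S) g"
    if "c \<in> ?S" "\<forall>k\<ge>1. continuous (at c within ?S) (f k)" for c
    using continuous_equi_stat_limit[of ?S f g c] good that by blast
  moreover have "fuzzy_bounded_on ?S g" if bd: "fuzzy_unif_bounded_on ?S f"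
  proof -
    obtain M where M: "\<And>k x. 1 \<le> k \<Longrightarrow> x \<in> ?S \<Longrightarrow> dist (f k x) fuzzy_zero \<le> M"
      using fuzzy_unif_bounded_onD[OF bd] by blast
    obtain N where N: "\<forall>x\<in>?S. \<forall>y\<in>?S.
        \<exists>k\<in>{1..N}. dist (f k x) (g x) < 1 \<and> dist (f k y) (g y) < 1"
      using good[of 1] by auto
    show ?thesis
    \<comment> \<open>\<open>M\<close> bounds the approximating \<open>f k\<close>, and the 1 is the
      accuracy chosen for \<open>N\<close>; only one of the two points matters here.\<close>
    proof (rule fuzzy_bounded_onI[where M = "M + 1"])
      fix x assume x: "x \<in> ?S"
      then obtain k where k: "k \<in> {1..N}" "dist (f k x) (g x) < 1" using N by blast
      then have "dist (f k x) fuzzy_zero \<le> M" using M x by simp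
      with k(2) show "dist (g x) fuzzy_zero \<le> M + 1"
        using dist_triangle[of "g x" fuzzy_zero "f k x"] by (simp add: dist_commute)
    qed
  qed
  ultimately show ?thesis by blast
qed

end
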